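(* Let $p$ and $q$ be primes and let $G$ be a finite group such that $\frac{G}{Z(G)}$ is isomorphic to a Frobenius group of order $p^2q$. Suppose that at least one of the following holds: (i) $\frac{G}{Z(G)} \cong A_4$; (ii) $p < q$ and $\left|\frac{G}{Z(G)}\right| \neq 12$; (iii) $p > q$. Then $\mathcal{CCC}(G)$ satisfies the Hansen-Vukičević conjecture, that is, $$\frac{M_2(\mathcal{CCC}(G))}{|e(\mathcal{CCC}(G))|} \geq \frac{M_1(\mathcal{CCC}(G))}{|v(\mathcal{CCC}(G))|}.$$
   Context: $Z(G)$ denotes the center of $G$ and $A_4$ the alternating group on four letters. For a finite group $G$ and $x \in G$, $x^G$ denotes the conjugacy class of $x$ in $G$. The commuting conjugacy class graph $\mathcal{CCC}(G)$ is the simple undirected graph whose vertices are the conjugacy classes of non-central elements of $G$, where two distinct vertices $x^G$ and $y^G$ are adjacent if and only if there exist $x' \in x^G$ and $y' \in y^G$ with $x'y' = y'x'$. For a finite simple graph $\Gamma$ with vertex set $v(\Gamma)$ and edge set $e(\Gamma)$, the first and second Zagreb indices are $M_1(\Gamma) = \sum_{v \in v(\Gamma)} \deg(v)^2$ and $M_2(\Gamma) = \sum_{uv \in e(\Gamma)} \deg(u)\deg(v)$. *)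

theory Defs
  imports Complex_Main "HOL-Algebra.Sym_Groups" "HOL-Computational_Algebra.Primes"
begin

section \<open>Group-theoretic notions\<close>

definition group_center :: "('a, 'b) monoid_scheme \<Rightarrow> 'a set" where
  "group_center G = {z \<in> carrier G. \<forall>g \<in> carrier G. z \<otimes>\<^bsub>G\<^esub> g = g \<otimes>\<^bsub>G\<^esub> z}"

definition conj_class :: "('a, 'b) monoid_scheme \<Rightarrow> 'a \<Rightarrow> 'a set" where
  "conj_class G x = {g \<otimes>\<^bsub>G\<^esub> x \<otimes>\<^bsub>G\<^esub> inv\<^bsub>G\<^esub> g | g. g \<in> carrier G}"

text \<open>A Frobenius group is a group with a Frobenius complement: a nontrivial proper subgroup
  meeting each of its conjugates by elements outside it trivially.\<close>

definition frobenius_group :: "('a, 'b) monoid_scheme \<Rightarrow> bool" where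
  "frobenius_group F \<longleftrightarrow> group F \<and>
     (\<exists>H. subgroup H F \<and> H \<noteq> {\<one>\<^bsub>F\<^esub>} \<and> H \<noteq> carrier F \<and>
        (\<forall>g \<in> carrier F - H. H \<inter> (g <#\<^bsub>F\<^esub> H #>\<^bsub>F\<^esub> inv\<^bsub>F\<^esub> g) = {\<one>\<^bsub>F\<^esub>}))"


section \<open>Simple graphs and Zagreb indices\<close>

text \<open>A simple undirected graph is given by its vertex set and its edge set, each edge being
  the two-element set of its endpoints.\<close>

type_synonym 'v sgraph = "'v set \<times> 'v set set"

abbreviation verts :: "'v sgraph \<Rightarrow> 'v set" where
  "verts \<equiv> fst"

abbreviation edges :: "'v sgraph \<Rightarrow> 'v set set" where
  "edges \<equiv> snd"

definition deg :: "'v sgraph \<Rightarrow> 'v \<Rightarrow> nat" where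
  "deg \<Gamma> v = card {e \<in> edges \<Gamma>. v \<in> e}"

definition zagreb1 :: "'v sgraph \<Rightarrow> nat" where
  "zagreb1 \<Gamma> = (\<Sum>v \<in> verts \<Gamma>. (deg \<Gamma> v)\<^sup>2)"

text \<open>As an edge is a two-element set \<open>{u, v}\<close>, the inner product is \<open>deg u * deg v\<close>.\<close>

definition zagreb2 :: "'v sgraph \<Rightarrow> nat" where
  "zagreb2 \<Gamma> = (\<Sum>e \<in> edges \<Gamma>. \<Prod>v \<in> e. deg \<Gamma> v)"


section \<open>The commuting conjugacy class graph\<close>

definition ccc_verts :: "('a, 'b) monoid_scheme \<Rightarrow> 'a set set" where
  "ccc_verts G = conj_class G ` (carrier G - group_center G)"

definition ccc_graph :: "('a, 'b) monoid_scheme \<Rightarrow> 'a set sgraph" where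
  "ccc_graph G =
     (ccc_verts G,
      {{X, Y} | X Y. X \<in> ccc_verts G \<and> Y \<in> ccc_verts G \<and> X \<noteq> Y \<and>
         (\<exists>x \<in> X. \<exists>y \<in> Y. x \<otimes>\<^bsub>G\<^esub> y = y \<otimes>\<^bsub>G\<^esub> x)})"

end

theory Submission
  imports Defs
begin

text \<open>If \<open>b\<close> is noncentral and commutes with \<open>a\<close> and \<open>c\<close>, while \<open>a\<close> and \<open>c\<close> do not commute, then
  \<open>Z(G) < C(C(b)) < C(a, b) < C(b) < G\<close> is a strict chain of subgroups, so the index of the center is a
  product of four factors exceeding 1. This is impossible if the index is \<open>p\<^sup>2q\<close>. Hence commuting
  is transitive on noncentral elements, the graph is a disjoint union of cliques, both ends of every
  edge have the same degree, and the inequality becomes Chebyshev's inequality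
  \<open>|V| \<Sum>d\<^sup>3 \<ge> (\<Sum>d\<^sup>2) (\<Sum>d)\<close> for the degrees \<open>d\<close>.\<close>

section \<open>Graphs whose edges join vertices of equal degree\<close>

text \<open>Double counting of incidences: \<open>f v\<close> is counted once for each edge at
  \<open>v\<close>. Constant \<open>f\<close> gives the handshake identity, and the squared degree
  gives the second Zagreb index as a sum over vertices.\<close>

lemma sum_edges_eq_sum_deg:
  fixes f :: "'v \<Rightarrow> nat"
  assumes "finite V" and "finite E" and "\<Union>E \<subseteq> V"
  shows "(\<Sum>e\<in>E. \<Sum>v\<in>e. f v) = (\<Sum>v\<in>V. deg (V, E) v * f v)"
proof -
  have "(\<Sum>e\<in>E. \<Sum>v\<in>e. f v) = (\<Sum>e\<in>E. \<Sum>v\<in>V. if v \<in> e then f v else 0)"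
  proof (rule sum.cong)
    fix e assume "e \<in> E"
    then have "V \<inter> e = e" using assms(3) by blast
    then show "(\<Sum>v\<in>e. f v) = (\<Sum>v\<in>V. if v \<in> e then f v else 0)"
      by (simp add: sum.inter_restrict[OF assms(1), symmetric])
  qed simp
  also have "\<dots> = (\<Sum>v\<in>V. \<Sum>e\<in>E. if v \<in> e then f v else 0)" by (rule sum.swap)
  also have "\<dots> = (\<Sum>v\<in>V. deg (V, E) v * f v)"
    by (intro sum.cong) (simp_all add: deg_def sum.inter_filter[OF assms(2), symmetric])
  finally show ?thesis .
qed

text \<open>Symmetrization: the sum of the nonnegative terms
  \<open>(d u - d v)\<^sup>2 * (d u + d v)\<close> over all ordered pairs expands to twice the
  difference of the two sides.\<close>

lemma sum_mult_sum_square_le: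
  fixes d :: "'v \<Rightarrow> real"
  assumes "\<And>v. v \<in> V \<Longrightarrow> d v \<ge> 0"
  shows "(\<Sum>v\<in>V. d v) * (\<Sum>v\<in>V. (d v)\<^sup>2) \<le> card V * (\<Sum>v\<in>V. (d v)^3)"
proof -
  have nonneg: "0 \<le> (\<Sum>u\<in>V. \<Sum>v\<in>V. (d u - d v)\<^sup>2 * (d u + d v))"
    using assms by (intro sum_nonneg mult_nonneg_nonneg add_nonneg_nonneg) auto
  have "(d u - d v)\<^sup>2 * (d u + d v) = d u ^ 3 + d v ^ 3 - (d u)\<^sup>2 * d v - d u * (d v)\<^sup>2" for u v
    by (simp add: power2_eq_square power3_eq_cube algebra_simps)
  then have "(\<Sum>u\<in>V. \<Sum>v\<in>V. (d u - d v)\<^sup>2 * (d u + d v))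
      = 2 * (card V * (\<Sum>v\<in>V. (d v)^3)) - 2 * ((\<Sum>v\<in>V. d v) * (\<Sum>v\<in>V. (d v)\<^sup>2))"
    by (simp add: sum.distrib sum_subtractf flip: sum_distrib_left sum_distrib_right)
  with nonneg show ?thesis by linarith
qed

lemma zagreb_ineq_of_equal_degrees:
  fixes V :: "'v set" and E :: "'v set set"
  assumes fin: "finite V"
    and edge: "\<And>e. e \<in> E \<Longrightarrow>
      \<exists>u v. e = {u, v} \<and> u \<noteq> v \<and> u \<in> V \<and> v \<in> V \<and> deg (V, E) u = deg (V, E) v"
  shows "real (zagreb2 (V, E)) / real (card E) \<ge> real (zagreb1 (V, E)) / real (card V)"
proof -
  let ?d = "deg (V, E)"
  have sub: "\<Union>E \<subseteq> V" using edge by blast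
  then have finE: "finite E" using fin finite_UnionD finite_subset by blast
  note count = sum_edges_eq_sum_deg[OF fin finE sub]
  have "(\<Sum>v\<in>e. 1) = (2::nat)" if "e \<in> E" for e
    using edge[OF that] by auto
  then have e: "2 * card E = (\<Sum>v\<in>V. ?d v)"
    using count[of "\<lambda>_. 1"] by simp
  \<comment> \<open>With common degree \<open>d\<close> at the two ends, both sides are twice the
    square of \<open>d\<close>.\<close>
  have "(\<Sum>v\<in>e. (?d v)\<^sup>2) = 2 * (\<Prod>v\<in>e. ?d v)" if "e \<in> E" for e
    using edge[OF that] by (auto simp: power2_eq_square)
  then have m2: "2 * zagreb2 (V, E) = (\<Sum>v\<in>V. ?d v ^ 3)"
    using count[of "\<lambda>v. (?d v)\<^sup>2"]
    by (simp add: zagreb2_def sum_distrib_left power3_eq_cube power2_eq_square mult.assoc)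
  show ?thesis
  proof (cases "E = {} \<or> V = {}")
    case True
    \<comment> \<open>Without edges all degrees vanish, and without vertices the sum is empty.
      Either way \<open>zagreb1\<close> is 0, so the smaller quotient is 0, also under the
      convention \<open>x / 0 = 0\<close>.\<close>
    then show ?thesis by (auto simp: zagreb1_def deg_def)
  next
    case False
    then have pos: "card E > 0" "card V > 0" using fin finE by auto
    have "(\<Sum>v\<in>V. real (?d v)) * (\<Sum>v\<in>V. (real (?d v))\<^sup>2) \<le> card V * (\<Sum>v\<in>V. (real (?d v))^3)"
      by (rule sum_mult_sum_square_le) simp
    also have "(\<Sum>v\<in>V. real (?d v)) = 2 * real (card E)"
      using arg_cong[OF e, of real] by simp
    also have "(\<Sum>v\<in>V. (real (?d v))^3) = 2 * real (zagreb2 (V, E))"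
      using arg_cong[OF m2, of real] by simp
    finally have "card E * real (zagreb1 (V, E)) \<le> card V * real (zagreb2 (V, E))"
      by (simp add: zagreb1_def)
    then show ?thesis using pos by (simp add: field_simps)
  qed
qed

text \<open>Edges at \<open>u\<close> correspond to their other endpoints. Since \<open>R\<close>
  may relate \<open>u\<close> to itself while the graph has no loops, \<open>u\<close> is
  removed.\<close>

lemma deg_relation_graph:
  assumes E: "E = {{X, Y} | X Y. X \<in> V \<and> Y \<in> V \<and> X \<noteq> Y \<and> R X Y}"
    and sym: "\<And>X Y. R X Y \<Longrightarrow> R Y X" and u: "u \<in> V"
  shows "deg (V, E) u = card ({w \<in> V. R u w} - {u})"
proof -
  have "{e \<in> E. u \<in> e} = (\<lambda>w. {u, w}) ` ({w \<in> V. R u w} - {u})"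
    using sym u unfolding E by (auto simp: doubleton_eq_iff image_iff)
  moreover have "inj_on (\<lambda>w. {u, w}) ({w \<in> V. R u w} - {u})"
    by (auto simp: inj_on_def doubleton_eq_iff)
  ultimately show ?thesis by (simp add: deg_def card_image)
qed

lemma zagreb_ineq_of_transitive_relation:
  assumes fin: "finite V" and E: "E = {{X, Y} | X Y. X \<in> V \<and> Y \<in> V \<and> X \<noteq> Y \<and> R X Y}"
    and sym: "\<And>X Y. R X Y \<Longrightarrow> R Y X"
    and trans: "\<And>X Y W. \<lbrakk>X \<in> V; Y \<in> V; W \<in> V; R X Y; R Y W\<rbrakk> \<Longrightarrow> R X W"
  shows "real (zagreb2 (V, E)) / real (card E) \<ge> real (zagreb1 (V, E)) / real (card V)"
proof (rule zagreb_ineq_of_equal_degrees[OF fin])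
  fix e assume "e \<in> E"
  then obtain u v where uv: "e = {u, v}" "u \<in> V" "v \<in> V" "u \<noteq> v" "R u v"
    unfolding E by blast
  let ?C = "{w \<in> V. R u w}"
  have C: "?C = {w \<in> V. R v w}" using uv sym trans by blast
  \<comment> \<open>Reflexivity is not assumed; it follows at an endpoint by going to
    \<open>v\<close> and back.\<close>
  have "R u u" using uv sym trans by blast
  then have "u \<in> ?C" "v \<in> ?C" using uv by auto
  then have "card (?C - {u}) = card (?C - {v})" by simp
  then have "deg (V, E) u = deg (V, E) v"
    using deg_relation_graph[OF E sym uv(2)] deg_relation_graph[OF E sym uv(3)] C by simp
  then show "\<exists>u v. e = {u, v} \<and> u \<noteq> v \<and> u \<in> V \<and> v \<in> V \<and> deg (V, E) u = deg (V, E) v"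
    using uv by blast
qed

section \<open>Centralizers and the index of the center\<close>

text \<open>Taking a set as argument makes every proper subgroup in the chain, including the center
  and the double centralizer, an instance of one notion.\<close>

definition centralizer :: "('a, 'b) monoid_scheme \<Rightarrow> 'a set \<Rightarrow> 'a set" where
  "centralizer G S = {g \<in> carrier G. \<forall>s\<in>S. g \<otimes>\<^bsub>G\<^esub> s = s \<otimes>\<^bsub>G\<^esub> g}"

lemma centralizer_subset: "centralizer G S \<subseteq> carrier G"
  by (auto simp: centralizer_def)

lemma (in group) subgroup_centralizer:
  assumes "S \<subseteq> carrier G"
  shows "subgroup (centralizer G S) G"
proof (rule subgroupI)
  fix g h assume g: "g \<in> centralizer G S" and h: "h \<in> centralizer G S"
  show "inv g \<in> centralizer G S"
    unfolding centralizer_def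
  proof (intro CollectI conjI ballI)
    show "inv g \<in> carrier G" using g by (simp add: centralizer_def)
    fix s assume "s \<in> S"
    then have "g \<in> carrier G" "s \<in> carrier G" "g \<otimes> s = s \<otimes> g"
      using g assms by (auto simp: centralizer_def)
    then show "inv g \<otimes> s = s \<otimes> inv g"
      by (metis inv_closed inv_solve_left inv_solve_right m_assoc m_closed)
  qed
  show "g \<otimes> h \<in> centralizer G S"
    using g h assms unfolding centralizer_def by (auto simp: subset_iff) (metis m_assoc)
qed (use assms in \<open>auto simp: centralizer_def subset_iff\<close>)

lemma group_center_eq_centralizer: "group_center G = centralizer G (carrier G)"
  by (simp add: group_center_def centralizer_def)

text \<open>Lagrange's theorem inside \<open>B\<close>: the factor \<open>k\<close> is the index of
  \<open>A\<close> in \<open>B\<close>.\<close>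

lemma (in group) subgroup_psubset_card:
  assumes "finite (carrier G)" and "subgroup A G" and "subgroup B G" and "A \<subset> B"
  obtains k where "k > 1" and "card B = k * card A"
proof -
  have finB: "finite B" using assms(1,3) by (meson finite_subset subgroup.subset)
  have "group (G\<lparr>carrier := B\<rparr>)" using assms(3) by (rule subgroup_imp_group)
  moreover have "subgroup A (G\<lparr>carrier := B\<rparr>)"
    using assms(2-4) by (simp add: subgroup_incl psubset_imp_subset)
  ultimately have "card (rcosets\<^bsub>G\<lparr>carrier := B\<rparr>\<^esub> A) * card A = card B"
    using group.lagrange by (fastforce simp: order_def)
  moreover have "card A < card B" by (rule psubset_card_mono[OF finB assms(4)])
  ultimately show thesis
    by (intro that[of "card (rcosets\<^bsub>G\<lparr>carrier := B\<rparr>\<^esub> A)"])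
      (metis One_nat_def less_one linorder_neqE_nat mult_0 mult_1 nat_less_le not_less_zero, simp)
qed

text \<open>Counted with multiplicity, the left side has three prime factors and the right side at
  least four.\<close>

lemma prime_square_mult_prime_ne_mult4:
  fixes p q :: nat
  assumes "prime p" and "prime q" and "a > 1" and "b > 1" and "c > 1" and "d > 1"
  shows "p\<^sup>2 * q \<noteq> a * b * c * d"
proof
  assume eq: "p\<^sup>2 * q = a * b * c * d"
  have one_le: "size (prime_factorization k) \<ge> 1" if "k > 1" for k :: nat
    using that by (simp add: Suc_le_eq nonempty_has_size[symmetric] prime_factorization_empty_iff)
  have "size (prime_factorization (p\<^sup>2 * q)) = 3"
    using assms(1,2) by (simp add: power2_eq_square prime_factorization_mult prime_factorization_prime)
  moreover have "size (prime_factorization (a * b * c * d)) \<ge> 4"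
    using assms(3-6) one_le[of a] one_le[of b] one_le[of c] one_le[of d]
    by (simp add: prime_factorization_mult)
  ultimately show False using eq by simp
qed

lemma (in group) commute_trans_of_center_index:
  fixes p q :: nat
  assumes fin: "finite (carrier G)" and "prime p" and "prime q"
    and index: "order (G Mod group_center G) = p\<^sup>2 * q"
    and carr: "a \<in> carrier G" "b \<in> carrier G" "c \<in> carrier G"
    and b: "b \<notin> group_center G" and ab: "a \<otimes> b = b \<otimes> a" and bc: "b \<otimes> c = c \<otimes> b"
  shows "a \<otimes> c = c \<otimes> a"
proof (rule ccontr)
  assume ac: "a \<otimes> c \<noteq> c \<otimes> a"
  let ?Z = "group_center G" and ?B = "centralizer G {b}" and ?A = "centralizer G {a, b}"
  let ?ZB = "centralizer G ?B"
  have aB: "a \<in> ?B" and cB: "c \<in> ?B" using carr ab bc by (auto simp: centralizer_def)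
  have sub: "subgroup ?Z G" "subgroup ?ZB G" "subgroup ?A G" "subgroup ?B G"
    unfolding group_center_eq_centralizer
    using carr by (simp_all add: subgroup_centralizer centralizer_subset)
  \<comment> \<open>The four strict inclusions are witnessed in turn by \<open>b\<close>,
    \<open>a\<close>, \<open>c\<close> and an element \<open>g\<close> that does not commute with
    \<open>b\<close>. Noncentrality of \<open>b\<close> gives the two outer ones; that
    \<open>a\<close> and \<open>c\<close> do not commute gives the two inner ones.\<close>
  have "b \<in> ?ZB" using carr by (auto simp: centralizer_def)
  then have 1: "?Z \<subset> ?ZB" using b by (auto simp: group_center_def centralizer_def)
  have "a \<in> ?A" "a \<notin> ?ZB" using carr ab ac cB by (auto simp: centralizer_def)
  moreover have "?ZB \<subseteq> ?A" using aB carr by (auto simp: centralizer_def)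
  ultimately have 2: "?ZB \<subset> ?A" by blast
  have "c \<notin> ?A" using ac by (auto simp: centralizer_def)
  then have 3: "?A \<subset> ?B" using cB by (auto simp: centralizer_def)
  obtain g where "g \<in> carrier G" "g \<otimes> b \<noteq> b \<otimes> g"
    using b carr unfolding group_center_def by force
  then have 4: "?B \<subset> carrier G" by (auto simp: centralizer_def)
  obtain i where i: "i > 1" "card ?ZB = i * card ?Z"
    using subgroup_psubset_card[OF fin sub(1,2) 1] .
  obtain j where j: "j > 1" "card ?A = j * card ?ZB"
    using subgroup_psubset_card[OF fin sub(2,3) 2] .
  obtain k where k: "k > 1" "card ?B = k * card ?A"
    using subgroup_psubset_card[OF fin sub(3,4) 3] .
  obtain l where l: "l > 1" "card (carrier G) = l * card ?B"
    using subgroup_psubset_card[OF fin sub(4) subgroup_self 4] .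
  have "p\<^sup>2 * q * card ?Z = card (carrier G)"
    using lagrange[OF sub(1)] index by (simp add: order_def FactGroup_def)
  then have "p\<^sup>2 * q * card ?Z = (l * k * j * i) * card ?Z"
    using i(2) j(2) k(2) l(2) by (simp add: mult.assoc)
  moreover have "card ?Z > 0"
    using fin sub(1) by (metis card_gt_0_iff finite_subset subgroup.subset subgroup_nonempty)
  ultimately have "p\<^sup>2 * q = l * k * j * i" by simp
  with prime_square_mult_prime_ne_mult4[OF assms(2,3) l(1) k(1) j(1) i(1)] show False ..
qed

section \<open>Conjugacy classes\<close>

text \<open>This allows any element of a vertex to serve as its representative: conjugating back by
  \<open>inv g\<close> recovers the original one.\<close>

lemma (in group) ccc_verts_closed:
  assumes X: "X \<in> ccc_verts G" and x: "x \<in> X"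
  shows "x \<in> carrier G" and "x \<notin> group_center G" and "X = conj_class G x"
proof -
  obtain x0 where x0: "x0 \<in> carrier G" "x0 \<notin> group_center G" "X = conj_class G x0"
    using X by (auto simp: ccc_verts_def)
  then obtain g where g: "g \<in> carrier G" "x = g \<otimes> x0 \<otimes> inv g"
    using x by (auto simp: conj_class_def)
  show "x \<in> carrier G" using g x0 by simp
  have x0_eq: "x0 = inv g \<otimes> x \<otimes> g"
    using g x0 by (simp add: m_assoc) (simp flip: m_assoc)
  show "x \<notin> group_center G"
  proof
    assume "x \<in> group_center G"
    then have "x \<otimes> g = g \<otimes> x" using g by (simp add: group_center_def)
    then have "x0 = x"
      unfolding x0_eq using g(1) \<open>x \<in> carrier G\<close> by (simp add: m_assoc) (simp flip: m_assoc)
    then show False using x0 \<open>x \<in> group_center G\<close> by simp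
  qed
  have "h \<otimes> x \<otimes> inv h = (h \<otimes> g) \<otimes> x0 \<otimes> inv (h \<otimes> g)" if "h \<in> carrier G" for h
    using that g x0 by (simp add: inv_mult_group m_assoc)
  moreover have "h \<otimes> x0 \<otimes> inv h = (h \<otimes> inv g) \<otimes> x \<otimes> inv (h \<otimes> inv g)" if "h \<in> carrier G" for h
    unfolding x0_eq using that g(1) \<open>x \<in> carrier G\<close> by (simp add: inv_mult_group m_assoc)
  ultimately show "X = conj_class G x"
    unfolding x0(3) conj_class_def using g(1) by blast
qed

lemma (in group) conj_commute:
  assumes "x \<in> carrier G" and "y \<in> carrier G" and "g \<in> carrier G" and "x \<otimes> y = y \<otimes> x"
  shows "(g \<otimes> x \<otimes> inv g) \<otimes> (g \<otimes> y \<otimes> inv g) = (g \<otimes> y \<otimes> inv g) \<otimes> (g \<otimes> x \<otimes> inv g)"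
proof -
  \<comment> \<open>Conjugation by \<open>g\<close> is multiplicative, hence preserves commuting
    pairs.\<close>
  have *: "(g \<otimes> u \<otimes> inv g) \<otimes> (g \<otimes> v \<otimes> inv g) = g \<otimes> (u \<otimes> v) \<otimes> inv g"
    if "u \<in> carrier G" "v \<in> carrier G" for u v
  proof -
    have "inv g \<otimes> (g \<otimes> (v \<otimes> inv g)) = v \<otimes> inv g"
      using that assms(3) by (simp flip: m_assoc)
    then show ?thesis using that assms(3) by (simp add: m_assoc)
  qed
  show ?thesis using assms by (simp add: *)
qed

text \<open>Transitivity passes from elements to classes, although two adjacencies at
  \<open>Y\<close> may use different elements of \<open>Y\<close>.\<close>

lemma (in group) zagreb_ineq_of_commute_trans:
  assumes fin: "finite (carrier G)"
    and trans: "\<And>a b c. \<lbrakk>a \<in> carrier G; b \<in> carrier G; c \<in> carrier G; b \<notin> group_center G;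
      a \<otimes> b = b \<otimes> a; b \<otimes> c = c \<otimes> b\<rbrakk> \<Longrightarrow> a \<otimes> c = c \<otimes> a"
  shows "real (zagreb2 (ccc_graph G)) / real (card (edges (ccc_graph G)))
       \<ge> real (zagreb1 (ccc_graph G)) / real (card (verts (ccc_graph G)))"
  unfolding ccc_graph_def fst_conv snd_conv
proof (rule zagreb_ineq_of_transitive_relation[where
      R = "\<lambda>X Y. \<exists>x\<in>X. \<exists>y\<in>Y. x \<otimes> y = y \<otimes> x", OF _ refl])
  show "finite (ccc_verts G)" using fin by (simp add: ccc_verts_def)
  show "\<exists>x\<in>Y. \<exists>y\<in>X. x \<otimes> y = y \<otimes> x" if "\<exists>x\<in>X. \<exists>y\<in>Y. x \<otimes> y = y \<otimes> x" for X Y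
    using that by metis
  fix X Y W assume V: "X \<in> ccc_verts G" "Y \<in> ccc_verts G" "W \<in> ccc_verts G"
  assume "\<exists>x\<in>X. \<exists>y\<in>Y. x \<otimes> y = y \<otimes> x" and "\<exists>x\<in>Y. \<exists>y\<in>W. x \<otimes> y = y \<otimes> x"
  then obtain x y y' w where xy: "x \<in> X" "y \<in> Y" "x \<otimes> y = y \<otimes> x"
    and yw: "y' \<in> Y" "w \<in> W" "y' \<otimes> w = w \<otimes> y'" by blast
  \<comment> \<open>Conjugation by \<open>g\<close> moves the pair \<open>x\<close>,
    \<open>y\<close> so that its second member becomes \<open>y'\<close>. Then \<open>y'\<close> is
    a noncentral link between the conjugate of \<open>x\<close> and \<open>w\<close>.\<close>
  obtain g where g: "g \<in> carrier G" "y' = g \<otimes> y \<otimes> inv g"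
    using yw(1) ccc_verts_closed(3)[OF V(2) xy(2)] by (auto simp: conj_class_def)
  let ?x = "g \<otimes> x \<otimes> inv g"
  note carr = ccc_verts_closed(1)[OF V(1) xy(1)] ccc_verts_closed(1)[OF V(2) xy(2)]
  have x: "?x \<in> X" using g ccc_verts_closed(3)[OF V(1) xy(1)] by (auto simp: conj_class_def)
  have "?x \<otimes> y' = y' \<otimes> ?x"
    unfolding g(2) by (rule conj_commute[OF carr g(1) xy(3)])
  then have "?x \<otimes> w = w \<otimes> ?x"
    using ccc_verts_closed(1)[OF V(1) x] ccc_verts_closed(1,2)[OF V(2) yw(1)]
      ccc_verts_closed(1)[OF V(3) yw(2)] yw(3) trans by blast
  then show "\<exists>x\<in>X. \<exists>y\<in>W. x \<otimes> y = y \<otimes> x" using x yw(2) by blast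
qed

theorem theorem2p13:
  fixes G :: "('a, 'b) monoid_scheme" and F :: "('c, 'd) monoid_scheme" and p q :: nat
  assumes "prime p" and "prime q"
    and "group G" and "finite (carrier G)"
    and "frobenius_group F" and "order F = p\<^sup>2 * q"
    and "G Mod group_center G \<cong> F"
    and "G Mod group_center G \<cong> alt_group 4
       \<or> (p < q \<and> order (G Mod group_center G) \<noteq> 12)
       \<or> p > q"
  shows "real (zagreb2 (ccc_graph G)) / real (card (edges (ccc_graph G)))
       \<ge> real (zagreb1 (ccc_graph G)) / real (card (verts (ccc_graph G)))"
proof -
  interpret group G by fact
  \<comment> \<open>The isomorphism with \<open>F\<close> turns the order of \<open>F\<close> into
    the index of the center.\<close>
  have "order (G Mod group_center G) = p\<^sup>2 * q"
    using assms(6,7) iso_same_card[of "G Mod group_center G" F] by (simp add: order_def)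
  then show ?thesis
    using commute_trans_of_center_index[OF assms(4,1,2)] assms(4)
    by (intro zagreb_ineq_of_commute_trans)
qed

end
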